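(* Consider a security game with homogeneous resources that can cover any one target. If $U_a^c(t_i)\ne E^*$ and $U_a^u(t_i)\ne E^*$ for every target $t_i\in T$, then the attacker has a unique Nash equilibrium strategy, i.e., there is exactly one attacker strategy $\mathbf{a}$ that is part of some Nash equilibrium.
   Context: The game is played between a defender and an attacker. There are a finite nonempty set of targets $T=\{t_1,\dots,t_n\}$ and $K$ identical defender resources, each of which can cover any single target (or remain unused). For each target $t$ there are real payoffs $U_d^c(t),U_d^u(t)$ (defender, $t$ attacked while covered/uncovered) and $U_a^c(t),U_a^u(t)$ (attacker), with $\Delta U_d(t):=U_d^c(t)-U_d^u(t)>0$ and $\Delta U_a(t):=U_a^u(t)-U_a^c(t)>0$. A mixed strategy of the defender (a distribution over assignments of resources to targets) affects utilities only through its vector $\mathbf{c}=(c_i)$ of marginal coverage probabilities; the feasible vectors are exactly those $\mathbf{c}\in[0,1]^n$ with $\sum_{i=1}^n c_i\le K$. Defender strategies are identified with such vectors. An attacker strategy $\mathbf{a}=(a_i)$ is a probability distribution on $T$. Utilities are $$U_d(\mathbf{c},\mathbf{a})=\sum_{i=1}^n a_i\big(c_iU_d^c(t_i)+(1-c_i)U_d^u(t_i)\big),\qquad U_a(\mathbf{c},\mathbf{a})=\sum_{i=1}^n a_i\big(c_iU_a^c(t_i)+(1-c_i)U_a^u(t_i)\big),$$ and $U_a(\mathbf{c},t_i)$ denotes the attacker's utility of attacking $t_i$ with probability 1. Let $E(\mathbf{c})=\max_i U_a(\mathbf{c},t_i)$ and $E^*=\min_{\mathbf{c}}E(\mathbf{c})$.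 A Nash equilibrium is $\langle\mathbf{c},\mathbf{a}\rangle$ with each strategy a best response to the other. *)

theory Defs
  imports "HOL-Analysis.Analysis"
begin

text \<open>
  Security games with homogeneous resources. The targets are the elements of a finite (hence
  nonempty) type \<open>'t\<close>. A defender mixed strategy is identified with its vector of marginal
  coverage probabilities; as every resource may cover any single target or stay unused, the
  vectors that arise are exactly those in \<open>coverage_vectors\<close> below.
\<close>

record 't security_game =
  resources :: nat
  Udc :: "'t \<Rightarrow> real"  \<comment> \<open>defender, target attacked while covered\<close>
  Udu :: "'t \<Rightarrow> real"  \<comment> \<open>defender, target attacked while uncovered\<close>
  Uac :: "'t \<Rightarrow> real"  \<comment> \<open>attacker, target attacked while covered\<close>
  Uau :: "'t \<Rightarrow> real"  \<comment> \<open>attacker, target attacked while uncovered\<close>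

definition valid_game :: "'t security_game \<Rightarrow> bool" where
  "valid_game G \<longleftrightarrow> (\<forall>t. Udc G t - Udu G t > 0 \<and> Uau G t - Uac G t > 0)"

definition coverage_vectors :: "'t::finite security_game \<Rightarrow> (real ^ 't) set" where
  "coverage_vectors G =
     {c. (\<forall>t. 0 \<le> c $ t \<and> c $ t \<le> 1) \<and> (\<Sum>t\<in>UNIV. c $ t) \<le> real (resources G)}"

definition attacker_strategies :: "(real ^ 't::finite) set" where
  "attacker_strategies = {a. (\<forall>t. 0 \<le> a $ t) \<and> (\<Sum>t\<in>UNIV. a $ t) = 1}"

definition Ud :: "'t::finite security_game \<Rightarrow> real ^ 't \<Rightarrow> real ^ 't \<Rightarrow> real" where
  "Ud G c a = (\<Sum>t\<in>UNIV. a $ t * (c $ t * Udc G t + (1 - c $ t) * Udu G t))"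

definition Ua :: "'t::finite security_game \<Rightarrow> real ^ 't \<Rightarrow> real ^ 't \<Rightarrow> real" where
  "Ua G c a = (\<Sum>t\<in>UNIV. a $ t * (c $ t * Uac G t + (1 - c $ t) * Uau G t))"

text \<open>The unit vector \<open>axis t 1\<close> is the pure attack on target \<open>t\<close>.\<close>

definition best_attack :: "'t::finite security_game \<Rightarrow> real ^ 't \<Rightarrow> real" where
  "best_attack G c = Max (range (\<lambda>t. Ua G c (axis t 1)))"

text \<open>
  The minimum of \<open>best_attack G\<close> over all coverage vectors. It is attained, see
  \<open>E_star_is_minimum\<close>, so \<open>LEAST\<close> is well defined here.
\<close>

definition E_star :: "'t::finite security_game \<Rightarrow> real" where
  "E_star G = (LEAST e. e \<in> best_attack G ` coverage_vectors G)"

definition nash_equilibrium :: "'t::finite security_game \<Rightarrow> real ^ 't \<Rightarrow> real ^ 't \<Rightarrow> bool" where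
  "nash_equilibrium G c a \<longleftrightarrow>
     c \<in> coverage_vectors G \<and> a \<in> attacker_strategies \<and>
     (\<forall>c'\<in>coverage_vectors G. Ud G c' a \<le> Ud G c a) \<and>
     (\<forall>a'\<in>attacker_strategies. Ua G c a' \<le> Ua G c a)"

lemma compact_coverage_vectors: "compact (coverage_vectors G)"
proof -
  have "coverage_vectors G =
      cbox 0 (\<chi> t. 1) \<inter> {c. (\<Sum>t\<in>UNIV. c $ t) \<le> real (resources G)}"
    by (auto simp: coverage_vectors_def mem_box_cart)
  moreover have "closed {c :: real ^ 'a. (\<Sum>t\<in>UNIV. c $ t) \<le> real (resources G)}"
    by (intro closed_Collect_le continuous_intros)
  ultimately show ?thesis
    by (simp add: compact_Int_closed)
qed

lemma continuous_on_Max_finite: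
  fixes f :: "'i \<Rightarrow> 'b::topological_space \<Rightarrow> real"
  assumes "finite I" "I \<noteq> {}" "\<And>i. i \<in> I \<Longrightarrow> continuous_on S (f i)"
  shows "continuous_on S (\<lambda>x. Max ((\<lambda>i. f i x) ` I))"
  using assms
proof (induction I rule: finite_ne_induct)
  case (insert i I)
  then have "continuous_on S (\<lambda>x. max (f i x) (Max ((\<lambda>i. f i x) ` I)))"
    by (intro continuous_on_max) auto
  with insert.hyps show ?case by simp
qed simp

lemma E_star_is_minimum:
  "\<exists>c\<in>coverage_vectors G. E_star G = best_attack G c \<and>
     (\<forall>c'\<in>coverage_vectors G. best_attack G c \<le> best_attack G c')"
proof -
  have "0 \<in> coverage_vectors G" by (simp add: coverage_vectors_def)
  then have ne: "coverage_vectors G \<noteq> {}" by blast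
  have "continuous_on (coverage_vectors G) (best_attack G)"
    unfolding best_attack_def Ua_def
    by (intro continuous_on_Max_finite continuous_intros) auto
  from continuous_attains_inf[OF compact_coverage_vectors ne this]
  obtain c where c: "c \<in> coverage_vectors G"
    "\<forall>c'\<in>coverage_vectors G. best_attack G c \<le> best_attack G c'" by blast
  then have "E_star G = best_attack G c"
    unfolding E_star_def by (intro Least_equality) auto
  with c show ?thesis by blast
qed

end

theory Submission imports Defs begin

text \<open>
  Let \<open>x\<close> be the least coverage that keeps every target's attacker utility at or below \<open>E_star\<close>;
  it is positive exactly on the targets \<open>T\<close> with \<open>Uau > E_star\<close>, and below 1 everywhere by
  hypothesis. Minimality of \<open>E_star\<close> forces \<open>x\<close> to use all resources. In an equilibrium
  \<open>(c, a)\<close> with attacker utility above \<open>E_star\<close>, every attacked target would be covered less by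
  \<open>c\<close> than by \<open>x\<close>, so the defender would gain by switching to \<open>x\<close>. Hence \<open>c \<ge> x\<close>, and so \<open>c = x\<close>
  by the resource bound. As \<open>x\<close> lies strictly between 0 and 1 on \<open>T\<close>, coverage can be shifted
  between any two targets of \<open>T\<close>, so \<open>a t * (Udc t - Udu t)\<close> is constant on \<open>T\<close>, while \<open>a\<close>
  vanishes off \<open>T\<close>. This determines \<open>a\<close>, and conversely this \<open>a\<close> is an equilibrium with \<open>x\<close>.
\<close>

section \<open>Attacker utilities and best responses\<close>

definition pay :: "'t::finite security_game \<Rightarrow> real ^ 't \<Rightarrow> 't \<Rightarrow> real" where
  "pay G c t = Uau G t - c $ t * (Uau G t - Uac G t)"

lemma Ua_eq_sum_pay: "Ua G c a = (\<Sum>t\<in>UNIV. a $ t * pay G c t)"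
  unfolding Ua_def pay_def by (intro sum.cong) (auto simp: algebra_simps)

lemma Ua_axis: "Ua G c (axis t 1) = pay G c t"
proof -
  have "Ua G c (axis t 1) = (\<Sum>s\<in>UNIV. if s = t then pay G c s else 0)"
    unfolding Ua_eq_sum_pay by (intro sum.cong) (auto simp: axis_def)
  then show ?thesis by simp
qed

lemma best_attack_eq: "best_attack G c = Max (range (pay G c))"
  by (simp add: best_attack_def Ua_axis)

lemma pay_le_best_attack: "pay G c t \<le> best_attack G c"
  by (simp add: best_attack_eq)

lemma best_attack_attained: "\<exists>t. pay G c t = best_attack G c"
proof -
  have "Max (range (pay G c)) \<in> range (pay G c)"
    by (intro Max_in) auto
  then show ?thesis unfolding best_attack_eq by (metis imageE)
qed

lemma axis_attacker_strategy: "axis t 1 \<in> attacker_strategies"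
  by (auto simp: attacker_strategies_def axis_def)

lemma Ua_le_of_pay_le:
  assumes "a \<in> attacker_strategies" "\<And>t. pay G c t \<le> e"
  shows "Ua G c a \<le> e"
proof -
  have "Ua G c a \<le> (\<Sum>t\<in>UNIV. a $ t * e)"
    unfolding Ua_eq_sum_pay
    using assms by (intro sum_mono mult_left_mono) (auto simp: attacker_strategies_def)
  also have "\<dots> = e"
    using assms(1) by (simp add: attacker_strategies_def flip: sum_distrib_right)
  finally show ?thesis .
qed

text \<open>The gaps to the best attack, weighted by \<open>a\<close>, are nonnegative. Their sum is
  nonpositive because \<open>a\<close> does at least as well as the best pure attack, so each of
  them vanishes.\<close>

lemma best_response_support:
  assumes a: "a \<in> attacker_strategies"
    and best: "\<And>a'. a' \<in> attacker_strategies \<Longrightarrow> Ua G c a' \<le> Ua G c a"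
    and "a $ t \<noteq> 0"
  shows "pay G c t = best_attack G c"
proof -
  let ?f = "\<lambda>t. a $ t * (best_attack G c - pay G c t)"
  have nonneg: "0 \<le> ?f s" for s
    using a by (auto simp: attacker_strategies_def pay_le_best_attack)
  obtain s where "pay G c s = best_attack G c"
    using best_attack_attained by blast
  then have "best_attack G c \<le> Ua G c a"
    using best[OF axis_attacker_strategy, of s] by (simp add: Ua_axis)
  moreover have "sum ?f UNIV = best_attack G c - Ua G c a"
    using a by (simp add: Ua_eq_sum_pay right_diff_distrib sum_subtractf
        attacker_strategies_def flip: sum_distrib_right)
  ultimately have "sum ?f UNIV = 0"
    using sum_nonneg[of UNIV ?f] nonneg by simp
  then have "?f t = 0"
    using nonneg by (simp add: sum_nonneg_eq_0_iff)
  with assms(3) show ?thesis by simp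
qed

text \<open>Isolates the dependence on \<open>c\<close>: the defender maximises a linear function of
  the coverage.\<close>

lemma Ud_eq:
  "Ud G c a = (\<Sum>t\<in>UNIV. a $ t * Udu G t) + (\<Sum>t\<in>UNIV. c $ t * (a $ t * (Udc G t - Udu G t)))"
  unfolding Ud_def sum.distrib[symmetric] by (intro sum.cong) (auto simp: algebra_simps)

section \<open>The least coverage holding the attacker to \<open>E_star\<close>\<close>

locale nondegenerate_game =
  fixes G :: "'t::finite security_game"
  assumes valid: "valid_game G"
    and Uac_neq: "\<And>t. Uac G t \<noteq> E_star G"
    and Uau_neq: "\<And>t. Uau G t \<noteq> E_star G"
begin

definition T :: "'t set" where
  "T = {t. Uau G t > E_star G}"

definition x :: "real ^ 't" where
  "x = (\<chi> t. if t \<in> T then (Uau G t - E_star G) / (Uau G t - Uac G t) else 0)"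

lemma Ud_gain: "Udc G t - Udu G t > 0" and Ua_gain: "Uau G t - Uac G t > 0"
  using valid by (auto simp: valid_game_def)

lemma pay_mono_iff: "pay G c t \<le> pay G c' t \<longleftrightarrow> c' $ t \<le> c $ t"
  using Ua_gain[of t] by (simp add: pay_def)

lemma pay_strict_mono_iff: "pay G c t < pay G c' t \<longleftrightarrow> c' $ t < c $ t"
  using Ua_gain[of t] by (simp add: pay_def)

lemma E_star_le: "c \<in> coverage_vectors G \<Longrightarrow> E_star G \<le> best_attack G c"
  using E_star_is_minimum[of G] by auto

text \<open>Even full coverage cannot push \<open>pay\<close> below \<open>Uac\<close>, so an
  optimal \<open>c\<close> gives the weak inequality; equality is excluded by hypothesis.\<close>

lemma Uac_less: "Uac G t < E_star G"
proof -
  obtain c where c: "c \<in> coverage_vectors G" "E_star G = best_attack G c"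
    using E_star_is_minimum by blast
  have "c $ t * (Uau G t - Uac G t) \<le> 1 * (Uau G t - Uac G t)"
    using c(1) Ua_gain[of t] by (intro mult_right_mono) (auto simp: coverage_vectors_def)
  then have "Uac G t \<le> pay G c t"
    by (simp add: pay_def)
  then show ?thesis
    using pay_le_best_attack[of G c t] c(2) Uac_neq[of t] by simp
qed

lemma pay_x: "t \<in> T \<Longrightarrow> pay G x t = E_star G"
  using Ua_gain[of t] by (simp add: pay_def x_def)

lemma pay_x_notin: "t \<notin> T \<Longrightarrow> pay G x t < E_star G"
  using Uau_neq[of t] by (simp add: pay_def x_def T_def)

lemma pay_x_le: "pay G x t \<le> E_star G"
  using pay_x pay_x_notin by (cases "t \<in> T") (auto intro: less_imp_le)

lemma x_pos: "t \<in> T \<Longrightarrow> 0 < x $ t"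
  using Ua_gain[of t] by (simp add: x_def T_def)

lemma x_notin: "t \<notin> T \<Longrightarrow> x $ t = 0"
  by (simp add: x_def)

lemma x_nonneg: "0 \<le> x $ t"
  using x_pos[of t] x_notin[of t] by (cases "t \<in> T") auto

lemma x_less_1: "x $ t < 1"
  using Ua_gain[of t] Uac_less[of t] by (simp add: x_def)

lemma x_le:
  assumes "\<And>t. 0 \<le> c $ t" "pay G c t \<le> E_star G"
  shows "x $ t \<le> c $ t"
  using assms pay_x[of t] x_notin[of t] by (cases "t \<in> T") (simp_all flip: pay_mono_iff)

lemma sum_x: "(\<Sum>t\<in>UNIV. x $ t) = real (resources G)"
proof (rule antisym)
  obtain c where c: "c \<in> coverage_vectors G" "E_star G = best_attack G c"
    using E_star_is_minimum by blast
  then have "x $ t \<le> c $ t" for t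
    by (intro x_le) (auto simp: coverage_vectors_def pay_le_best_attack)
  then have "(\<Sum>t\<in>UNIV. x $ t) \<le> (\<Sum>t\<in>UNIV. c $ t)"
    by (intro sum_mono)
  then show "(\<Sum>t\<in>UNIV. x $ t) \<le> real (resources G)"
    using c(1) by (auto simp: coverage_vectors_def)
next
  show "real (resources G) \<le> (\<Sum>t\<in>UNIV. x $ t)"
  proof (rule ccontr)
    assume "\<not> ?thesis"
    then have less: "(\<Sum>t\<in>UNIV. x $ t) < real (resources G)" by simp
    \<comment> \<open>No coordinate will rise by more than \<open>\<delta>\<close>, so dividing by
      the number of targets respects the budget; the cap at 1 keeps coverages at most 1.\<close>
    define \<delta> where "\<delta> = min 1 ((real (resources G) - (\<Sum>t\<in>UNIV. x $ t)) / CARD('t))"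
    have \<delta>: "0 < \<delta>" "\<delta> \<le> 1" "\<delta> * CARD('t) \<le> real (resources G) - (\<Sum>t\<in>UNIV. x $ t)"
      using less by (auto simp: \<delta>_def min_def field_simps)
    \<comment> \<open>Moving \<open>x\<close> towards full coverage strictly lowers the attacker's utility everywhere.\<close>
    define c :: "real ^ 't" where "c = (\<chi> t. x $ t + \<delta> * (1 - x $ t))"
    have "x $ t < c $ t" for t
      using \<delta>(1) x_less_1[of t] by (simp add: c_def)
    then have "pay G c t < E_star G" for t
      using pay_strict_mono_iff[of c t x] pay_x_le[of t] by auto
    then have "best_attack G c < E_star G"
      using best_attack_attained[of G c] by metis
    moreover have "c \<in> coverage_vectors G"
    proof -
      have "0 \<le> c $ t" for t
        using \<delta> x_nonneg[of t] x_less_1[of t] by (simp add: c_def)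
      moreover have "c $ t \<le> 1" for t
        using \<delta> x_less_1[of t] mult_left_le_one_le[of "1 - x $ t" \<delta>]
        unfolding c_def vec_lambda_beta by linarith
      moreover have "(\<Sum>t\<in>UNIV. c $ t) \<le> (\<Sum>t\<in>UNIV. x $ t + \<delta>)"
        using \<delta> x_nonneg by (intro sum_mono) (auto simp: c_def algebra_simps)
      then have "(\<Sum>t\<in>UNIV. c $ t) \<le> real (resources G)"
        using \<delta>(3) by (simp add: sum.distrib mult.commute)
      ultimately show ?thesis by (simp add: coverage_vectors_def)
    qed
    ultimately show False
      using E_star_le by fastforce
  qed
qed

lemma x_coverage: "x \<in> coverage_vectors G"
  using x_nonneg x_less_1 sum_x by (auto simp: coverage_vectors_def intro: less_imp_le)

text \<open>As \<open>x\<close> is feasible, its best attack is worth at least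
  \<open>E_star\<close>, a value not reached off \<open>T\<close>.\<close>

lemma T_nonempty: "T \<noteq> {}"
proof -
  obtain t where "pay G x t = best_attack G x"
    using best_attack_attained by blast
  then have "t \<in> T"
    using E_star_le[OF x_coverage] pay_x_notin[of t] by force
  then show ?thesis by blast
qed

section \<open>Existence of an equilibrium attack\<close>

definition W :: real where
  "W = (\<Sum>t\<in>T. 1 / (Udc G t - Udu G t))"

lemma W_pos: "0 < W"
  unfolding W_def using T_nonempty Ud_gain by (intro sum_pos) auto

text \<open>With these weights, a unit of coverage is worth the same \<open>1 / W\<close> to the
  defender on every target of \<open>T\<close>.\<close>

definition eq_attack :: "real ^ 't" where
  "eq_attack = (\<chi> t. if t \<in> T then 1 / W / (Udc G t - Udu G t) else 0)"

lemma sum_eq_attack: "(\<Sum>t\<in>UNIV. eq_attack $ t) = 1"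
proof -
  have "(\<Sum>t\<in>UNIV. eq_attack $ t) = (\<Sum>t\<in>T. 1 / W * (1 / (Udc G t - Udu G t)))"
    by (simp add: eq_attack_def sum.If_cases)
  also have "\<dots> = 1"
    using W_pos by (simp only: W_def flip: sum_distrib_left) simp
  finally show ?thesis .
qed

text \<open>The defender's utility depends on the coverage only through its total on
  \<open>T\<close>, where \<open>x\<close> spends all resources. The attack is optimal because
  \<open>pay G x\<close> equals its upper bound \<open>E_star\<close> on \<open>T\<close>.\<close>

lemma nash_eq_attack: "nash_equilibrium G x eq_attack"
proof -
  have strat: "eq_attack \<in> attacker_strategies"
    using sum_eq_attack less_imp_le[OF W_pos] less_imp_le[OF Ud_gain]
    unfolding attacker_strategies_def by (simp add: eq_attack_def del: divide_divide_eq_left)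
  have gain: "eq_attack $ t * (Udc G t - Udu G t) = (if t \<in> T then 1 / W else 0)" for t
    using Ud_gain[of t] by (simp add: eq_attack_def)
  have Ud_T: "Ud G c eq_attack = (\<Sum>t\<in>UNIV. eq_attack $ t * Udu G t) + (\<Sum>t\<in>T. c $ t) / W" for c
  proof -
    have "(\<Sum>t\<in>UNIV. c $ t * (if t \<in> T then 1 / W else 0)) = (\<Sum>t\<in>T. c $ t / W)"
      by (simp add: if_distrib sum.If_cases cong: if_cong)
    then show ?thesis by (simp add: Ud_eq gain sum_divide_distrib)
  qed
  have "Ud G c eq_attack \<le> Ud G x eq_attack" if c: "c \<in> coverage_vectors G" for c
  proof -
    have "(\<Sum>t\<in>T. c $ t) \<le> (\<Sum>t\<in>UNIV. c $ t)"
      using c by (intro sum_mono2) (auto simp: coverage_vectors_def)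
    also have "\<dots> \<le> (\<Sum>t\<in>UNIV. x $ t)"
      using c by (simp add: coverage_vectors_def sum_x)
    also have "\<dots> = (\<Sum>t\<in>T. x $ t)"
      by (intro sum.mono_neutral_right) (auto simp: x_notin)
    finally show ?thesis
      using W_pos by (simp add: Ud_T divide_right_mono)
  qed
  moreover have "Ua G x eq_attack = E_star G"
  proof -
    have "Ua G x eq_attack = (\<Sum>t\<in>UNIV. eq_attack $ t * E_star G)"
      unfolding Ua_eq_sum_pay by (intro sum.cong) (auto simp: eq_attack_def pay_x)
    then show ?thesis by (simp add: sum_eq_attack flip: sum_distrib_right)
  qed
  ultimately show ?thesis
    using strat x_coverage Ua_le_of_pay_le[OF _ pay_x_le] by (auto simp: nash_equilibrium_def)
qed

section \<open>Uniqueness of coverage and attack\<close>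

lemma nash_coverage:
  assumes "nash_equilibrium G c a"
  shows "c = x"
proof -
  have c: "c \<in> coverage_vectors G" and a: "a \<in> attacker_strategies"
    and def: "Ud G x a \<le> Ud G c a"
    and att: "\<And>a'. a' \<in> attacker_strategies \<Longrightarrow> Ua G c a' \<le> Ua G c a"
    using assms x_coverage by (auto simp: nash_equilibrium_def)
  have a_nonneg: "0 \<le> a $ t" for t
    using a by (simp add: attacker_strategies_def)
  have "best_attack G c \<le> E_star G"
  proof (rule ccontr)
    assume gt: "\<not> ?thesis"
    have less: "c $ t < x $ t" if "a $ t \<noteq> 0" for t
      using best_response_support[OF a att that] gt pay_x_le[of t]
      by (simp flip: pay_strict_mono_iff)
    let ?v = "\<lambda>t. a $ t * (Udc G t - Udu G t)"
    have v: "0 < ?v t" if "a $ t \<noteq> 0" for t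
      using that a_nonneg[of t] Ud_gain[of t] by auto
    obtain s where s: "a $ s \<noteq> 0"
      using a by (force simp: attacker_strategies_def)
    have "(\<Sum>t\<in>UNIV. c $ t * ?v t) < (\<Sum>t\<in>UNIV. x $ t * ?v t)"
    proof (rule sum_strict_mono_ex1)
      have "c $ t * ?v t \<le> x $ t * ?v t" for t
        using less[of t] v[of t] by (cases "a $ t = 0") (auto intro!: mult_right_mono)
      then show "\<forall>t\<in>UNIV. c $ t * ?v t \<le> x $ t * ?v t" by blast
      show "\<exists>t\<in>UNIV. c $ t * ?v t < x $ t * ?v t"
        using less[OF s] v[OF s] by (intro bexI[of _ s] mult_strict_right_mono) auto
    qed simp
    with def show False by (simp add: Ud_eq)
  qed
  then have le: "x $ t \<le> c $ t" for t
    using c order_trans[OF pay_le_best_attack]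
    by (intro x_le) (auto simp: coverage_vectors_def)
  \<comment> \<open>\<open>x\<close> already exhausts the budget that bounds the total of
    \<open>c\<close>, so the nonnegative differences have no room.\<close>
  have "(\<Sum>t\<in>UNIV. c $ t - x $ t) \<le> 0"
    using c by (simp add: sum_subtractf sum_x coverage_vectors_def)
  then have "(\<Sum>t\<in>UNIV. c $ t - x $ t) = 0"
    using le by (intro antisym sum_nonneg) auto
  then have "c $ t - x $ t = 0" for t
    using le by (subst (asm) sum_nonneg_eq_0_iff) auto
  then show ?thesis by (simp add: vec_eq_iff)
qed

lemma nash_gain_le:
  assumes nash: "nash_equilibrium G x a" and s: "s \<in> T" and t: "t \<in> T"
  shows "a $ t * (Udc G t - Udu G t) \<le> a $ s * (Udc G s - Udu G s)"
proof (cases "s = t")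
  case False
  let ?v = "\<lambda>t. a $ t * (Udc G t - Udu G t)"
  \<comment> \<open>The largest amount that can move from \<open>s\<close> to \<open>t\<close>;
    positive since \<open>x\<close> lies strictly between 0 and 1 on \<open>T\<close>.\<close>
  define e where "e = min (x $ s) (1 - x $ t)"
  have e: "0 < e" "e \<le> x $ s" "e \<le> 1 - x $ t"
    using x_pos[OF s] x_less_1[of t] by (auto simp: e_def)
  define d where "d = axis t e - axis s e"
  have d: "(\<Sum>r\<in>UNIV. d $ r * f r) = e * (f t - f s)" for f
  proof -
    have "(\<Sum>r\<in>UNIV. d $ r * f r) =
        (\<Sum>r\<in>UNIV. if r = t then e * f r else 0) - (\<Sum>r\<in>UNIV. if r = s then e * f r else 0)"
      unfolding sum_subtractf[symmetric] by (intro sum.cong) (auto simp: d_def axis_def)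
    then show ?thesis by (simp add: algebra_simps)
  qed
  have "(\<Sum>r\<in>UNIV. (x + d) $ r) = real (resources G)"
    using d[of "\<lambda>_. 1"] by (simp add: sum.distrib sum_x)
  moreover have "0 \<le> (x + d) $ r \<and> (x + d) $ r \<le> 1" for r
    using e False x_nonneg[of r] x_less_1[of r] by (auto simp: d_def axis_def)
  ultimately have "x + d \<in> coverage_vectors G"
    by (simp add: coverage_vectors_def)
  then have "Ud G (x + d) a \<le> Ud G x a"
    using nash by (simp add: nash_equilibrium_def)
  then have "e * (?v t - ?v s) \<le> 0"
    using d[of ?v] by (simp add: Ud_eq distrib_right sum.distrib)
  with e(1) show ?thesis by (simp add: mult_le_0_iff)
qed simp

lemma nash_attack:
  assumes "nash_equilibrium G c a"
  shows "a = eq_attack"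
proof -
  have nash: "nash_equilibrium G x a"
    using assms nash_coverage by blast
  then have a: "a \<in> attacker_strategies"
    and att: "\<And>a'. a' \<in> attacker_strategies \<Longrightarrow> Ua G x a' \<le> Ua G x a"
    by (auto simp: nash_equilibrium_def)
  have off: "a $ t = 0" if "t \<notin> T" for t
    using best_response_support[OF a att, of t] E_star_le[OF x_coverage] pay_x_notin[OF that]
    by force
  obtain s where s: "s \<in> T"
    using T_nonempty by blast
  define w where "w = a $ s * (Udc G s - Udu G s)"
  have on: "a $ t = w * (1 / (Udc G t - Udu G t))" if "t \<in> T" for t
  proof -
    have "a $ t * (Udc G t - Udu G t) = w"
      \<comment> \<open>Shifting coverage in both directions turns the inequality into an
        equality.\<close>
      unfolding w_def using nash_gain_le[OF nash s that] nash_gain_le[OF nash that s] by simp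
    then show ?thesis
      using Ud_gain[of t] by (simp add: field_simps)
  qed
  \<comment> \<open>Total probability 1 fixes the only remaining unknown, \<open>w\<close>.\<close>
  have "1 = (\<Sum>t\<in>T. a $ t)"
    using a off sum.mono_neutral_right[of UNIV T "\<lambda>t. a $ t"]
    by (simp add: attacker_strategies_def)
  also have "\<dots> = w * W"
    by (simp add: on W_def sum_distrib_left)
  finally have "w = 1 / W"
    using W_pos by (simp add: field_simps)
  then show ?thesis
    using on off by (simp add: vec_eq_iff eq_attack_def)
qed

end

theorem theorem3p11:
  fixes G :: "'t::finite security_game"
  assumes "valid_game G"
    and "\<And>t. Uac G t \<noteq> E_star G"
    and "\<And>t. Uau G t \<noteq> E_star G"
  shows "\<exists>!a. \<exists>c. nash_equilibrium G c a"
proof -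
  interpret nondegenerate_game G
    using assms by unfold_locales
  show ?thesis
    using nash_eq_attack nash_attack by blast
qed

end
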